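(* Let $(\mathcal{N},[\cdot,\dots,\cdot]_\mathcal{N},B)$ be a quadratic $n$-ary Nambu-Lie algebra and let $\alpha\in Aut_S(\mathcal{N},B)$ be an involution ($\alpha^2=id$). Let $\mathcal{L}=\mathcal{N}\oplus\mathcal{N}^*$ with the $n$-ary bracket $$[x_1+f_1,\dots,x_n+f_n]_\mathcal{L}=[x_1,\dots,x_n]_\mathcal{N}+\sum_{i=1}^n(-1)^{i+n+1}f_i\circ L(x_1,\dots,\widehat{x_i},\dots,x_n),$$ where $x_i\in\mathcal{N}$, $f_i\in\mathcal{N}^*$, $L(z_1,\dots,z_{n-1})(z)=[z_1,\dots,z_{n-1},z]_\mathcal{N}$ and $\widehat{x_i}$ means $x_i$ is omitted, and with the bilinear form $B_\mathcal{L}(x+f,y+g)=B(x,y)+f(y)+g(x)$. Define $\Omega:\mathcal{L}\to\mathcal{L}$ by $\Omega(x+f)=\alpha(x)+f\circ\alpha$, and put $[\cdot,\dots,\cdot]_\Omega=\Omega\circ[\cdot,\dots,\cdot]_\mathcal{L}$ and $\widetilde\Omega=(\Omega,\dots,\Omega)$ ($n-1$ copies). Then $(\mathcal{L},[\cdot,\dots,\cdot]_\Omega,\widetilde\Omega,B_\mathcal{L},\Omega)$ is a Hom-quadratic multiplicative $n$-ary Hom-Nambu algebra.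
   Context: $\mathbb{K}$ is an algebraically closed field of characteristic zero and $n\ge 2$. An $n$-ary Hom-Nambu algebra is a triple $(\mathcal{N},[\cdot,\dots,\cdot],\tilde\alpha)$ with $\mathcal{N}$ a $\mathbb{K}$-vector space, $[\cdot,\dots,\cdot]:\mathcal{N}^n\to\mathcal{N}$ an $n$-linear map and $\tilde\alpha=(\alpha_1,\dots,\alpha_{n-1})$ linear maps $\mathcal{N}\to\mathcal{N}$ such that $$[\alpha_1(x_1),\dots,\alpha_{n-1}(x_{n-1}),[y_1,\dots,y_n]]=\sum_{i=1}^n[\alpha_1(y_1),\dots,\alpha_{i-1}(y_{i-1}),[x_1,\dots,x_{n-1},y_i],\alpha_i(y_{i+1}),\dots,\alpha_{n-1}(y_n)].$$ It is multiplicative if $\alpha_1=\dots=\alpha_{n-1}=\alpha$ and $\alpha([x_1,\dots,x_n])=[\alpha(x_1),\dots,\alpha(x_n)]$. It is an $n$-ary Nambu algebra when all $\alpha_i=id$, and an $n$-ary Nambu-Lie algebra if moreover the bracket is skew-symmetric. An $n$-ary Nambu(-Lie) algebra is quadratic with respect to $B$ if $B$ is a nondegenerate symmetric bilinear form such that $B([x_1,\dots,x_{n-1},y],z)+B(y,[x_1,\dots,x_{n-1},z])=0$. $(\mathcal{N},[\cdot,\dots,\cdot],\tilde\alpha,B,\beta)$ is a Hom-quadratic $n$-ary Hom-Nambu algebra if $B$ is a nondegenerate symmetric bilinear form and $\beta\in End(\mathcal{N})$ satisfies $B([x_1,\dots,x_{n-1},y],\beta(z))+B(\beta(y),[x_1,\dots,x_{n-1},z])=0$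 for all elements. $Aut_S(\mathcal{N},B)$ is the set of algebra automorphisms $f$ of $\mathcal{N}$ with $B(f(x),y)=B(x,f(y))$ for all $x,y$. *)

theory Defs
  imports
    Main
    "HOL-Computational_Algebra.Polynomial"
    "HOL-Combinatorics.Permutations"
    "HOL-Library.Function_Algebras"
    "HOL-Library.Product_Plus"
begin

text \<open>
  All algebras live on a subspace \<open>N\<close> of an ambient vector space \<open>'v\<close>: the dual space, and hence
  \<open>N \<oplus> N\<^sup>*\<close>, is a subspace of a function type. A bracket with \<open>n\<close> arguments is a function on
  lists, of which only the values on lists of length \<open>n\<close> over \<open>N\<close> matter.
\<close>

definition tuples :: "'v set \<Rightarrow> nat \<Rightarrow> 'v list set" where
  "tuples N n = {xs. length xs = n \<and> set xs \<subseteq> N}"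

definition linear_on ::
  "('k \<Rightarrow> 'v \<Rightarrow> 'v) \<Rightarrow> 'v set \<Rightarrow> ('k \<Rightarrow> 'w \<Rightarrow> 'w) \<Rightarrow> ('v::plus \<Rightarrow> 'w::plus) \<Rightarrow> bool" where
  "linear_on s1 N s2 f \<longleftrightarrow>
     (\<forall>x\<in>N. \<forall>y\<in>N. f (x + y) = f x + f y) \<and> (\<forall>c. \<forall>x\<in>N. f (s1 c x) = s2 c (f x))"

definition endomorphism_on :: "('k \<Rightarrow> 'v \<Rightarrow> 'v) \<Rightarrow> 'v set \<Rightarrow> ('v::plus \<Rightarrow> 'v) \<Rightarrow> bool" where
  "endomorphism_on s N f \<longleftrightarrow> linear_on s N s f \<and> f ` N \<subseteq> N"

locale nary_algebra = vector_space scale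
  for scale :: "'k::field \<Rightarrow> 'v::ab_group_add \<Rightarrow> 'v" +
  fixes N :: "'v set" and n :: nat and br :: "'v list \<Rightarrow> 'v"
  assumes subspace_carrier: "subspace N"
    and bracket_closed: "xs \<in> tuples N n \<Longrightarrow> br xs \<in> N"
    and bracket_multilinear:
      "xs \<in> tuples N n \<Longrightarrow> i < n \<Longrightarrow> linear_on scale N scale (\<lambda>x. br (xs[i := x]))"

text \<open>
  List indices start at \<open>0\<close>. In the \<open>i\<close>-th summand below the entries before position \<open>i\<close> are
  twisted by the map with the same index and the entries after it by the map whose index is
  one less.
\<close>

locale hom_nambu_algebra = nary_algebra scale N n br
  for scale :: "'k::field \<Rightarrow> 'v::ab_group_add \<Rightarrow> 'v" and N n br +
  fixes \<alpha>s :: "('v \<Rightarrow> 'v) list"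
  assumes length_twists: "length \<alpha>s = n - 1"
    and twists_linear: "a \<in> set \<alpha>s \<Longrightarrow> endomorphism_on scale N a"
    and hom_nambu_identity:
      "xs \<in> tuples N (n - 1) \<Longrightarrow> ys \<in> tuples N n \<Longrightarrow>
        br (map2 (\<lambda>a x. a x) \<alpha>s xs @ [br ys]) =
        (\<Sum>i<n. br (map2 (\<lambda>a y. a y) (take i \<alpha>s) (take i ys)
                   @ [br (xs @ [ys ! i])]
                   @ map2 (\<lambda>a y. a y) (drop i \<alpha>s) (drop (Suc i) ys)))"

locale multiplicative_hom_nambu_algebra = hom_nambu_algebra +
  assumes multiplicative:
    "\<exists>\<alpha>. (\<forall>a\<in>set \<alpha>s. \<forall>x\<in>N. a x = \<alpha> x) \<and> (\<forall>xs\<in>tuples N n. \<alpha> (br xs) = br (map \<alpha> xs))"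

locale nambu_algebra = hom_nambu_algebra scale N n br "replicate (n - 1) id"
  for scale :: "'k::field \<Rightarrow> 'v::ab_group_add \<Rightarrow> 'v" and N n br

locale nambu_lie_algebra = nambu_algebra +
  assumes skew_symmetric:
    "p permutes {..<n} \<Longrightarrow> xs \<in> tuples N n \<Longrightarrow>
      br (permute_list p xs) = scale (of_int (sign p)) (br xs)"

definition nondegenerate_symmetric_bilinear ::
  "('k::field \<Rightarrow> 'v \<Rightarrow> 'v) \<Rightarrow> 'v::ab_group_add set \<Rightarrow> ('v \<Rightarrow> 'v \<Rightarrow> 'k) \<Rightarrow> bool" where
  "nondegenerate_symmetric_bilinear s N B \<longleftrightarrow>
     (\<forall>x\<in>N. linear_on s N (*) (\<lambda>y. B x y)) \<and>
     (\<forall>y\<in>N. linear_on s N (*) (\<lambda>x. B x y)) \<and>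
     (\<forall>x\<in>N. \<forall>y\<in>N. B x y = B y x) \<and>
     (\<forall>x\<in>N. (\<forall>y\<in>N. B x y = 0) \<longrightarrow> x = 0)"

locale quadratic_nambu_lie_algebra = nambu_lie_algebra scale N n br
  for scale :: "'k::field \<Rightarrow> 'v::ab_group_add \<Rightarrow> 'v" and N n br +
  fixes B :: "'v \<Rightarrow> 'v \<Rightarrow> 'k"
  assumes form: "nondegenerate_symmetric_bilinear scale N B"
    and form_invariant:
      "xs \<in> tuples N (n - 1) \<Longrightarrow> y \<in> N \<Longrightarrow> z \<in> N \<Longrightarrow>
        B (br (xs @ [y])) z + B y (br (xs @ [z])) = 0"

locale hom_quadratic_hom_nambu_algebra = hom_nambu_algebra scale N n br \<alpha>s
  for scale :: "'k::field \<Rightarrow> 'v::ab_group_add \<Rightarrow> 'v" and N n br \<alpha>s +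
  fixes B :: "'v \<Rightarrow> 'v \<Rightarrow> 'k" and \<beta> :: "'v \<Rightarrow> 'v"
  assumes form: "nondegenerate_symmetric_bilinear scale N B"
    and \<beta>_endomorphism: "endomorphism_on scale N \<beta>"
    and form_hom_invariant:
      "xs \<in> tuples N (n - 1) \<Longrightarrow> y \<in> N \<Longrightarrow> z \<in> N \<Longrightarrow>
        B (br (xs @ [y])) (\<beta> z) + B (\<beta> y) (br (xs @ [z])) = 0"

definition symmetric_automorphisms ::
  "('k::field \<Rightarrow> 'v \<Rightarrow> 'v) \<Rightarrow> 'v::ab_group_add set \<Rightarrow> nat \<Rightarrow> ('v list \<Rightarrow> 'v) \<Rightarrow>
   ('v \<Rightarrow> 'v \<Rightarrow> 'k) \<Rightarrow> ('v \<Rightarrow> 'v) set" where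
  "symmetric_automorphisms s N n br B =
     {f. endomorphism_on s N f \<and> bij_betw f N N \<and>
         (\<forall>xs\<in>tuples N n. f (br xs) = br (map f xs)) \<and>
         (\<forall>x\<in>N. \<forall>y\<in>N. B (f x) y = B x (f y))}"

text \<open>
  From here on the given algebra is carried by a whole type \<open>'v\<close>. Its dual is the full algebraic
  dual; no finiteness of dimension is assumed. Pairs \<open>(x, f)\<close> stand for \<open>x + f\<close>.
\<close>

definition dual :: "('k::field \<Rightarrow> 'v \<Rightarrow> 'v) \<Rightarrow> ('v::ab_group_add \<Rightarrow> 'k) set" where
  "dual scale = {f. Vector_Spaces.linear scale (*) f}"

definition ext_carrier ::
  "('k::field \<Rightarrow> 'v \<Rightarrow> 'v) \<Rightarrow> ('v::ab_group_add \<times> ('v \<Rightarrow> 'k)) set" where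
  "ext_carrier scale = UNIV \<times> dual scale"

definition ext_scale ::
  "('k::field \<Rightarrow> 'v \<Rightarrow> 'v) \<Rightarrow> 'k \<Rightarrow> 'v::ab_group_add \<times> ('v \<Rightarrow> 'k) \<Rightarrow> 'v \<times> ('v \<Rightarrow> 'k)" where
  "ext_scale scale c = (\<lambda>(x, f). (scale c x, \<lambda>z. c * f z))"

definition left_mult :: "('v list \<Rightarrow> 'v) \<Rightarrow> 'v list \<Rightarrow> 'v \<Rightarrow> 'v" where
  "left_mult br zs z = br (zs @ [z])"

text \<open>The sign exponent uses \<open>Suc i\<close> because list positions start at \<open>0\<close>.\<close>

definition ext_bracket ::
  "nat \<Rightarrow> ('v list \<Rightarrow> 'v) \<Rightarrow> ('v \<times> ('v \<Rightarrow> 'k::field)) list \<Rightarrow> 'v \<times> ('v \<Rightarrow> 'k)" where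
  "ext_bracket n br us =
     (let xs = map fst us; fs = map snd us in
       (br xs,
        \<lambda>z. \<Sum>i<n. (-1) ^ (Suc i + n + 1) *
                   (fs ! i \<circ> left_mult br (take i xs @ drop (Suc i) xs)) z))"

definition ext_form ::
  "('v \<Rightarrow> 'v \<Rightarrow> 'k::field) \<Rightarrow> 'v \<times> ('v \<Rightarrow> 'k) \<Rightarrow> 'v \<times> ('v \<Rightarrow> 'k) \<Rightarrow> 'k" where
  "ext_form B = (\<lambda>(x, f) (y, g). B x y + f y + g x)"

definition ext_map ::
  "('v \<Rightarrow> 'v) \<Rightarrow> 'v \<times> ('v \<Rightarrow> 'k) \<Rightarrow> 'v \<times> ('v \<Rightarrow> 'k)" where
  "ext_map \<alpha> = (\<lambda>(x, f). (\<alpha> x, f \<circ> \<alpha>))"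

end

theory Submission
  imports Defs
begin

text \<open>
  By skew-symmetry, the functional part of the bracket on \<open>N \<oplus> N\<^sup>*\<close> is
  \<open>z \<mapsto> - (\<Sum>i. f\<^sub>i [x\<^sub>1, \<dots>, z, \<dots>, x\<^sub>n])\<close> with \<open>z\<close> in position \<open>i\<close>. The Nambu identity of the
  extension then splits into the terms carrying a functional of the inner bracket, which is the
  Nambu identity of \<open>N\<close>, and the terms carrying a functional of the outer one, which is its transpose
  with respect to \<open>B\<close>, as \<open>B [x\<^sub>1, \<dots>, x\<^sub>n] z\<close> is alternating in all \<open>n + 1\<close> arguments. The map \<open>\<Omega>\<close>
  is an involutive isometric automorphism of the extension, so twisting by it (Yau's method)
  yields the Hom-structure.
\<close>

section \<open>Argument lists, tuples and pointwise sums\<close>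

lemma map2_apply_replicate:
  "length xs \<le> m \<Longrightarrow> map2 (\<lambda>a x. a x) (replicate m f) xs = map f xs"
proof (induction xs arbitrary: m)
  case (Cons x xs)
  then show ?case by (cases m) auto
qed simp

lemma sum_fun_apply: "(\<Sum>i\<in>A. f i) x = (\<Sum>i\<in>A. f i x)"
  by (induction A rule: infinite_finite_induct) auto

lemma tuples_list_update: "xs \<in> tuples N n \<Longrightarrow> x \<in> N \<Longrightarrow> xs[i := x] \<in> tuples N n"
  unfolding tuples_def using set_update_subset_insert by fastforce

lemma tuples_nth: "xs \<in> tuples N n \<Longrightarrow> i < n \<Longrightarrow> xs ! i \<in> N"
  unfolding tuples_def using nth_mem by blast

lemma tuples_snoc: "xs \<in> tuples N (n - 1) \<Longrightarrow> x \<in> N \<Longrightarrow> 0 < n \<Longrightarrow> xs @ [x] \<in> tuples N n"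
  unfolding tuples_def by auto

lemma tuples_map: "xs \<in> tuples N n \<Longrightarrow> f ` N \<subseteq> N \<Longrightarrow> map f xs \<in> tuples N n"
  unfolding tuples_def by auto

section \<open>The untwisted Nambu identity and its twist by an endomorphism\<close>

context nary_algebra
begin

text \<open>With identity twists the three blocks of a summand concatenate to \<open>ys\<close> with
  entry \<open>i\<close> replaced. The \<open>n - 1\<close> twists match the \<open>n - 1\<close>
  entries that remain around position \<open>i\<close>, so \<open>map2\<close> truncates
  nothing.\<close>

lemma nambu_algebra_iff:
  assumes "0 < n"
  shows "nambu_algebra scale N n br \<longleftrightarrow>
    (\<forall>xs\<in>tuples N (n - 1). \<forall>ys\<in>tuples N n.
       br (xs @ [br ys]) = (\<Sum>i<n. br (ys[i := br (xs @ [ys ! i])])))"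
    (is "_ \<longleftrightarrow> (\<forall>xs\<in>_. \<forall>ys\<in>_. ?P xs ys)")
proof -
  have *: "(br (map2 (\<lambda>a x. a x) (replicate (n - 1) id) xs @ [br ys]) =
      (\<Sum>i<n. br (map2 (\<lambda>a y. a y) (take i (replicate (n - 1) id)) (take i ys)
        @ [br (xs @ [ys ! i])]
        @ map2 (\<lambda>a y. a y) (drop i (replicate (n - 1) id)) (drop (Suc i) ys)))) = ?P xs ys"
    if "xs \<in> tuples N (n - 1)" "ys \<in> tuples N n" for xs ys
    using that assms
    by (auto simp: tuples_def map2_apply_replicate upd_conv_take_nth_drop min_def
        intro!: arg_cong[where f = "(=) _"] sum.cong)
  show ?thesis
    unfolding nambu_algebra_def hom_nambu_algebra_def hom_nambu_algebra_axioms_def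
    using * nary_algebra_axioms
    by (auto simp: endomorphism_on_def linear_on_def)
qed

end

text \<open>Since \<open>\<phi>\<close> commutes with \<open>br\<close>, its copies on the arguments
  can be pulled out of the bracket. Both sides of the twisted identity thus become
  \<open>\<phi>\<close> applied twice to the sides of the untwisted one.\<close>

lemma multiplicative_twist:
  assumes nambu: "nambu_algebra scale N n br" and n: "0 < n"
    and endo: "endomorphism_on scale N \<phi>"
    and hom: "\<And>xs. xs \<in> tuples N n \<Longrightarrow> \<phi> (br xs) = br (map \<phi> xs)"
  shows "multiplicative_hom_nambu_algebra scale N n (\<phi> \<circ> br) (replicate (n - 1) \<phi>)"
proof -
  interpret nambu_algebra scale N n br by (fact nambu)
  have nambu_identity: "br (xs @ [br ys]) = (\<Sum>i<n. br (ys[i := br (xs @ [ys ! i])]))"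
    if "xs \<in> tuples N (n - 1)" "ys \<in> tuples N n" for xs ys
    using nambu that unfolding nambu_algebra_iff[OF n] by blast
  have closed: "\<phi> ` N \<subseteq> N" and add: "\<And>x y. x \<in> N \<Longrightarrow> y \<in> N \<Longrightarrow> \<phi> (x + y) = \<phi> x + \<phi> y"
    and scale: "\<And>c x. x \<in> N \<Longrightarrow> \<phi> (scale c x) = scale c (\<phi> x)"
    using endo by (auto simp: endomorphism_on_def linear_on_def)
  have sum: "(\<forall>i\<in>A. h i \<in> N) \<Longrightarrow> \<phi> (\<Sum>i\<in>A. h i) = (\<Sum>i\<in>A. \<phi> (h i))" for h and A :: "nat set"
  proof (induction A rule: infinite_finite_induct)
    case (insert i A)
    moreover from insert.prems have "(\<Sum>j\<in>A. h j) \<in> N"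
      by (intro subspace_sum[OF subspace_carrier]) simp
    ultimately show ?case by (simp add: add)
  \<comment> \<open>Scaling by \<open>0\<close> gives \<open>\<phi> 0 = 0\<close>, which settles the
    empty sum and the default value \<open>0\<close> of an infinite one.\<close>
  qed (use scale[of 0 0] subspace_0[OF subspace_carrier] in auto)
  interpret twisted: nary_algebra scale N n "\<phi> \<circ> br"
  proof
    show "subspace N" by (rule subspace_carrier)
    show "(\<phi> \<circ> br) xs \<in> N" if "xs \<in> tuples N n" for xs
      using bracket_closed[OF that] closed by auto
    show "linear_on scale N scale (\<lambda>x. (\<phi> \<circ> br) (xs[i := x]))"
      if "xs \<in> tuples N n" "i < n" for xs i
      using bracket_multilinear[OF that] bracket_closed[OF tuples_list_update[OF that(1)]]
      by (simp add: linear_on_def add scale)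
  qed
  show ?thesis
  proof
    show "length (replicate (n - 1) \<phi>) = n - 1" by simp
    show "endomorphism_on scale N a" if "a \<in> set (replicate (n - 1) \<phi>)" for a
      using that endo by (auto split: if_splits)
    show "\<exists>\<alpha>. (\<forall>a\<in>set (replicate (n - 1) \<phi>). \<forall>x\<in>N. a x = \<alpha> x) \<and>
        (\<forall>xs\<in>tuples N n. \<alpha> ((\<phi> \<circ> br) xs) = (\<phi> \<circ> br) (map \<alpha> xs))"
      by (intro exI[of _ \<phi>]) (auto simp: hom)
    fix xs ys assume xs: "xs \<in> tuples N (n - 1)" and ys: "ys \<in> tuples N n"
    have inner: "br (xs @ [ys ! i]) \<in> N" if "i < n" for i
      by (intro bracket_closed tuples_snoc tuples_nth[OF ys] xs n that)
    have "(\<phi> \<circ> br) (map2 (\<lambda>a x. a x) (replicate (n - 1) \<phi>) xs @ [(\<phi> \<circ> br) ys])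
        = \<phi> (br (map \<phi> (xs @ [br ys])))"
      using xs by (simp add: map2_apply_replicate tuples_def)
    also have "\<dots> = \<phi> (\<phi> (br (xs @ [br ys])))"
      by (subst hom) (intro tuples_snoc xs n bracket_closed ys, rule refl)
    also have "\<dots> = (\<Sum>i<n. \<phi> (\<phi> (br (ys[i := br (xs @ [ys ! i])]))))"
    proof -
      have N: "br (ys[i := br (xs @ [ys ! i])]) \<in> N" if "i < n" for i
        by (intro bracket_closed tuples_list_update ys inner that)
      with closed have "\<phi> (br (ys[i := br (xs @ [ys ! i])])) \<in> N" if "i < n" for i
        using that by blast
      with N show ?thesis
        by (simp add: nambu_identity[OF xs ys] sum)
    qed
    also have "\<dots> = (\<Sum>i<n. (\<phi> \<circ> br) (map2 (\<lambda>a y. a y) (take i (replicate (n - 1) \<phi>)) (take i ys)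
        @ [(\<phi> \<circ> br) (xs @ [ys ! i])]
        @ map2 (\<lambda>a y. a y) (drop i (replicate (n - 1) \<phi>)) (drop (Suc i) ys)))"
    proof (intro sum.cong refl)
      fix i assume "i \<in> {..<n}"
      then have i: "i < n" by simp
      have "\<phi> (br (ys[i := br (xs @ [ys ! i])])) = br (map \<phi> (ys[i := br (xs @ [ys ! i])]))"
        by (intro hom tuples_list_update ys inner i)
      also have "map \<phi> (ys[i := br (xs @ [ys ! i])]) =
          map \<phi> (take i ys) @ [\<phi> (br (xs @ [ys ! i]))] @ map \<phi> (drop (Suc i) ys)"
        using ys i by (simp add: tuples_def upd_conv_take_nth_drop)
      finally show "\<phi> (\<phi> (br (ys[i := br (xs @ [ys ! i])]))) =
          (\<phi> \<circ> br) (map2 (\<lambda>a y. a y) (take i (replicate (n - 1) \<phi>)) (take i ys)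
            @ [(\<phi> \<circ> br) (xs @ [ys ! i])]
            @ map2 (\<lambda>a y. a y) (drop i (replicate (n - 1) \<phi>)) (drop (Suc i) ys))"
        using ys i by (simp add: map2_apply_replicate tuples_def min_def)
    qed
    finally show "(\<phi> \<circ> br) (map2 (\<lambda>a x. a x) (replicate (n - 1) \<phi>) xs @ [(\<phi> \<circ> br) ys]) =
        (\<Sum>i<n. (\<phi> \<circ> br) (map2 (\<lambda>a y. a y) (take i (replicate (n - 1) \<phi>)) (take i ys)
          @ [(\<phi> \<circ> br) (xs @ [ys ! i])]
          @ map2 (\<lambda>a y. a y) (drop i (replicate (n - 1) \<phi>)) (drop (Suc i) ys)))" .
  qed
qed

section \<open>Skew-symmetry and the invariant form on an algebra carried by a whole type\<close>

locale full_quadratic_nambu_lie_algebra = quadratic_nambu_lie_algebra scale UNIV n br B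
  for scale :: "'k::field \<Rightarrow> 'v::ab_group_add \<Rightarrow> 'v" and n br B +
  assumes n_pos: "0 < n"
begin

lemma tuples_UNIV: "tuples UNIV m = {xs. length xs = m}"
  by (simp add: tuples_def)

lemma bracket_add:
  "length xs = n \<Longrightarrow> i < n \<Longrightarrow> br (xs[i := x + y]) = br (xs[i := x]) + br (xs[i := y])"
  and bracket_scale: "length xs = n \<Longrightarrow> i < n \<Longrightarrow> br (xs[i := scale c x]) = scale c (br (xs[i := x]))"
  using bracket_multilinear[of xs i] by (auto simp: linear_on_def tuples_UNIV)

lemma bracket_uminus: "length xs = n \<Longrightarrow> i < n \<Longrightarrow> br (xs[i := - x]) = - br (xs[i := x])"
  using bracket_scale[of xs i "-1" x] by simp

lemma nambu_identity:
  assumes "length xs = n - 1" "length ys = n"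
  shows "br (xs @ [br ys]) = (\<Sum>i<n. br (ys[i := br (xs @ [ys ! i])]))"
  using nambu_algebra_axioms assms unfolding nambu_algebra_iff[OF n_pos] by (auto simp: tuples_UNIV)

lemma bracket_swap:
  assumes "length xs = n" "i < n" "j < n" "i \<noteq> j"
  shows "br (xs[i := a, j := b]) = - br (xs[i := b, j := a])"
proof -
  let ?p = "transpose i j" and ?xs = "xs[i := b, j := a]"
  have p: "?p permutes {..<n}" using assms by (intro permutes_swap_id) auto
  have "permute_list ?p ?xs = xs[i := a, j := b]"
    using assms p by (intro nth_equalityI)
      (auto simp: permute_list_nth nth_list_update transpose_def)
  with skew_symmetric[OF p, of ?xs] assms show ?thesis
    by (simp add: tuples_UNIV sign_swap_id)
qed

lemma bracket_swap_last:
  assumes "length xs = n - 1" "k < n - 1"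
  shows "br (xs[k := a] @ [b]) = - br (xs[k := b] @ [a])"
  using bracket_swap[of "xs @ [b]" k "n - 1" a b] assms n_pos
  by (simp add: list_update_append)

text \<open>Each entry of \<open>bs\<close> that \<open>z\<close> passes costs one sign. In the
  induction the head of \<open>bs\<close> joins the prefix \<open>as\<close>, and one adjacent swap
  carries \<open>z\<close> past it.\<close>

lemma bracket_move_last:
  "length as + length bs = n - 1 \<Longrightarrow>
    br (as @ bs @ [z]) = scale ((-1) ^ length bs) (br (as @ z # bs))"
proof (induction bs arbitrary: as)
  case (Cons b bs)
  have "br (as @ b # z # bs) = - br (as @ z # b # bs)"
    using bracket_swap[of "as @ b # z # bs" "length as" "Suc (length as)" b z] Cons.prems
    by (simp add: list_update_append)
  with Cons.IH[of "as @ [b]"] Cons.prems show ?case by simp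
qed simp

text \<open>This trades an omitted argument for a list update: \<open>z\<close> travels from the
  last slot back to the vacant slot \<open>i\<close>, past \<open>n - Suc i\<close> entries.\<close>

lemma left_mult_omit:
  assumes "length xs = n" "i < n"
  shows "left_mult br (take i xs @ drop (Suc i) xs) z = scale ((-1) ^ (n - Suc i)) (br (xs[i := z]))"
  using bracket_move_last[of "take i xs" "drop (Suc i) xs" z] assms
  by (simp add: left_mult_def upd_conv_take_nth_drop)

lemma form_add_left: "B (x + y) z = B x z + B y z"
  and form_add_right: "B z (x + y) = B z x + B z y"
  and form_scale_left: "B (scale c x) z = c * B x z"
  and form_scale_right: "B z (scale c x) = c * B z x"
  and form_sym: "B x y = B y x"
  and form_nondegenerate: "(\<And>y. B x y = 0) \<Longrightarrow> x = 0"
  using form by (auto simp: nondegenerate_symmetric_bilinear_def linear_on_def)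

lemma form_uminus_left: "B (- x) z = - B x z"
  using form_scale_left[of "-1" x z] by simp

lemma form_uminus_right: "B z (- x) = - B z x"
  using form_scale_right[of z "-1" x] by simp

lemma form_sum_left: "B (\<Sum>i\<in>A. h i) z = (\<Sum>i\<in>A. B (h i) z)"
  using form_scale_left[of 0 0 z]
  by (induction A rule: infinite_finite_induct) (auto simp: form_add_left)

lemma form_sum_right: "B z (\<Sum>i\<in>A. h i) = (\<Sum>i\<in>A. B z (h i))"
  using form_sum_left[of h A z] by (simp add: form_sym[of z])

lemma form_invariant_last:
  "length xs = n - 1 \<Longrightarrow> B (br (xs @ [y])) z = - B y (br (xs @ [z]))"
  using form_invariant[of xs y z] by (simp add: tuples_UNIV eq_neg_iff_add_eq_0)

text \<open>Invariance is given for the last slot. Moving the argument from there to slot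
  \<open>i\<close> puts the same sign on both brackets, and this nonzero sign cancels.\<close>

lemma form_invariant_at:
  assumes "length xs = n" "i < n"
  shows "B (br (xs[i := y])) z = - B y (br (xs[i := z]))"
proof -
  let ?ys = "take i xs @ drop (Suc i) xs" and ?s = "(-1) ^ (n - Suc i) :: 'k"
  have "?s * B (br (xs[i := y])) z = ?s * (- B y (br (xs[i := z])))"
    using form_invariant_last[of ?ys y z] left_mult_omit[OF assms] assms
    by (simp add: left_mult_def form_scale_left form_scale_right)
  then show ?thesis by (rule mult_left_cancel[THEN iffD1, rotated]) simp
qed

text \<open>
  The transpose of the Nambu identity: it is obtained by moving \<open>w\<close> in \<open>B _ w\<close> through the
  brackets, applying the Nambu identity, and moving \<open>z\<close> back.
\<close>

lemma nambu_identity_transposed: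
  assumes xs: "length xs = n - 1" and ys: "length ys = n" and k: "k < n - 1"
  shows "(\<Sum>i<n. br (xs[k := br (ys[i := z])] @ [ys ! i])) = - br (xs[k := z] @ [br ys])"
    (is "?l = ?r")
proof -
  have upd: "length (xs[k := a]) = n - 1" for a using xs by simp
  have "B ?l w = B ?r w" for w
  proof -
    let ?E = "\<lambda>i. br (xs[k := w] @ [ys ! i])"
    have "B (br (xs[k := br (ys[i := z])] @ [ys ! i])) w = B z (br (ys[i := ?E i]))"
      if "i < n" for i
    proof -
      \<comment> \<open>The swap brings the inner bracket into the last slot, where invariance can
        move it to the other side of \<open>B\<close>; a second use of invariance, in slot
        \<open>i\<close>, then frees \<open>z\<close>.\<close>
      have "B (br (xs[k := br (ys[i := z])] @ [ys ! i])) w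
          = - B (br (xs[k := ys ! i] @ [br (ys[i := z])])) w"
        by (subst bracket_swap_last[OF xs k]) (simp add: form_uminus_left)
      also have "\<dots> = B (br (ys[i := z])) (br (xs[k := ys ! i] @ [w]))"
        by (simp add: form_invariant_last[OF upd])
      also have "\<dots> = - B z (br (ys[i := br (xs[k := ys ! i] @ [w])]))"
        using form_invariant_at[OF ys that] .
      also have "br (xs[k := ys ! i] @ [w]) = - ?E i"
        by (rule bracket_swap_last[OF xs k])
      finally show ?thesis
        using bracket_uminus[OF ys that] by (simp add: form_uminus_right)
    qed
    \<comment> \<open>The sum of the \<open>br (ys[i := ?E i])\<close> is the right-hand side of the
      Nambu identity with left arguments \<open>xs[k := w]\<close>.\<close>
    then have "B ?l w = B z (br (xs[k := w] @ [br ys]))"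
      by (simp add: form_sum_left form_sum_right nambu_identity[OF upd ys])
    also have "\<dots> = - B (br (xs[k := w] @ [z])) (br ys)"
      by (simp add: form_invariant_last[OF upd])
    also have "\<dots> = B (br (xs[k := z] @ [w])) (br ys)"
      by (subst bracket_swap_last[OF xs k]) (simp add: form_uminus_left)
    also have "\<dots> = B ?r w"
      using form_invariant_last[OF upd, of z w "br ys"] form_sym[of w "br (xs[k := z] @ [br ys])"]
      by (simp add: form_uminus_left)
    finally show ?thesis .
  qed
  then have "B (?l - ?r) w = 0" for w
    using form_add_left[of ?l "- ?r" w] by (simp add: form_uminus_left)
  then have "?l - ?r = 0" by (rule form_nondegenerate)
  then show ?thesis by (simp only: right_minus_eq)
qed

section \<open>Linear functionals\<close>

lemma vector_space_mult: "vector_space ((*) :: 'k \<Rightarrow> 'k \<Rightarrow> 'k)"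
  by standard (auto simp: algebra_simps)

lemma mem_dual_iff:
  "f \<in> dual scale \<longleftrightarrow> (\<forall>x y. f (x + y) = f x + f y) \<and> (\<forall>c x. f (scale c x) = c * f x)"
  unfolding dual_def Vector_Spaces.linear_iff using vector_space_mult vector_space_axioms by auto

lemma
  assumes "f \<in> dual scale"
  shows dual_add: "f (x + y) = f x + f y"
    and dual_scale: "f (scale c x) = c * f x"
    and dual_zero: "f 0 = 0"
    and dual_uminus: "f (- x) = - f x"
    and dual_sum: "f (\<Sum>i\<in>A. h i) = (\<Sum>i\<in>A. f (h i))"
proof -
  show add: "f (x + y) = f x + f y" and scale: "f (scale c x) = c * f x" for x y c
    using assms by (auto simp: mem_dual_iff)
  show zero: "f 0 = 0" using scale[of 0 0] by simp
  show "f (- x) = - f x" using scale[of "-1" x] by simp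
  show "f (\<Sum>i\<in>A. h i) = (\<Sum>i\<in>A. f (h i))"
    by (induction A rule: infinite_finite_induct) (auto simp: add zero)
qed

section \<open>The extension by the dual as an n-ary algebra\<close>

abbreviation E :: "('v \<times> ('v \<Rightarrow> 'k)) set" where "E \<equiv> ext_carrier scale"
abbreviation ebr :: "('v \<times> ('v \<Rightarrow> 'k)) list \<Rightarrow> 'v \<times> ('v \<Rightarrow> 'k)" where "ebr \<equiv> ext_bracket n br"

lemma mem_ext_carrier_iff: "u \<in> E \<longleftrightarrow> snd u \<in> dual scale"
  by (cases u) (simp add: ext_carrier_def)

lemma snd_nth_dual: "us \<in> tuples E m \<Longrightarrow> i < m \<Longrightarrow> snd (us ! i) \<in> dual scale"
  using tuples_nth mem_ext_carrier_iff by blast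

lemma fst_ext_bracket: "fst (ebr us) = br (map fst us)"
  by (simp add: ext_bracket_def Let_def)

text \<open>The exponent \<open>Suc i + n + 1\<close> in the definition and the exponent
  \<open>n - Suc i\<close> from \<open>left_mult_omit\<close> add up to \<open>2 * n + 1\<close>, so
  the sign is \<open>-1\<close> for every \<open>i\<close>. The later computations use this
  sign-free form.\<close>

lemma snd_ext_bracket:
  assumes us: "us \<in> tuples E n"
  shows "snd (ebr us) z = - (\<Sum>i<n. snd (us ! i) (br ((map fst us)[i := z])))"
proof -
  have len: "length us = n" using us by (simp add: tuples_def)
  have sign: "(-1) ^ (Suc i + n + 1) *
      snd (us ! i) (left_mult br (take i (map fst us) @ drop (Suc i) (map fst us)) z)
      = - snd (us ! i) (br ((map fst us)[i := z]))" if i: "i < n" for i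
  proof -
    have "Suc i + n + 1 + (n - Suc i) = Suc (2 * n)" using i by simp
    then have "(-1) ^ (Suc i + n + 1) * (-1) ^ (n - Suc i) = (-1 :: 'k)"
      by (simp only: power_add[symmetric] power_minus1_odd)
    moreover have "left_mult br (take i (map fst us) @ drop (Suc i) (map fst us)) z =
        scale ((-1) ^ (n - Suc i)) (br ((map fst us)[i := z]))"
      using i len by (intro left_mult_omit) simp_all
    ultimately show ?thesis
      by (simp only: dual_scale[OF snd_nth_dual[OF us i]] mult.assoc[symmetric]) simp
  qed
  show ?thesis
    unfolding ext_bracket_def Let_def snd_conv comp_def sum_negf[symmetric]
    by (intro sum.cong refl) (use len in \<open>simp only: nth_map lessThan_iff sign\<close>)
qed

lemma fst_ext_scale: "fst (ext_scale scale c u) = scale c (fst u)"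
  and snd_ext_scale: "snd (ext_scale scale c u) = (\<lambda>z. c * snd u z)"
  by (simp_all add: ext_scale_def case_prod_beta)

lemma vector_space_ext: "vector_space (ext_scale scale)"
  by standard (simp_all add: prod_eq_iff fst_ext_scale snd_ext_scale fun_eq_iff algebra_simps)

lemma subspace_ext_carrier: "module.subspace (ext_scale scale) E"
proof -
  interpret ext: vector_space "ext_scale scale" by (rule vector_space_ext)
  show ?thesis
    by (auto simp: ext.subspace_def mem_ext_carrier_iff mem_dual_iff snd_ext_scale algebra_simps)
qed

lemma ext_bracket_closed:
  assumes us: "us \<in> tuples E n"
  shows "ebr us \<in> E"
proof -
  have len: "length us = n" using us by (simp add: tuples_def)
  show ?thesis
    using len
    by (simp add: mem_ext_carrier_iff mem_dual_iff snd_ext_bracket[OF us] bracket_add bracket_scale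
        dual_add[OF snd_nth_dual[OF us]] dual_scale[OF snd_nth_dual[OF us]]
        sum.distrib sum_distrib_left)
qed

lemma ext_bracket_multilinear:
  assumes us: "us \<in> tuples E n" and i: "i < n"
  shows "linear_on (ext_scale scale) E (ext_scale scale) (\<lambda>u. ebr (us[i := u]))"
proof -
  have len: "length us = n" using us by (simp add: tuples_def)
  have closed: "u + v \<in> E" "ext_scale scale c u \<in> E" if "u \<in> E" "v \<in> E" for u v c
    using that by (auto simp: mem_ext_carrier_iff mem_dual_iff snd_ext_scale algebra_simps)
  let ?xs = "map fst us"
  \<comment> \<open>Each summand depends on only one component of \<open>u\<close>: for
    \<open>j = i\<close> the vector part is overwritten by \<open>z\<close> and the functional
    remains, otherwise only the vector part enters, in slot \<open>i\<close>.\<close>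
  have snd_upd: "snd (ebr (us[i := u])) z = - (\<Sum>j<n. if j = i then snd u (br (?xs[i := z]))
      else snd (us ! j) (br (?xs[j := z, i := fst u])))" if "u \<in> E" for u z
    unfolding snd_ext_bracket[OF tuples_list_update[OF us that]]
    using len i by (auto simp: map_update list_update_swap intro!: sum.cong)
  have add: "ebr (us[i := u + v]) = ebr (us[i := u]) + ebr (us[i := v])"
    if uv: "u \<in> E" "v \<in> E" for u v
  proof (rule prod_eqI)
    show "fst (ebr (us[i := u + v])) = fst (ebr (us[i := u]) + ebr (us[i := v]))"
      using len i by (simp add: fst_ext_bracket map_update bracket_add)
    show "snd (ebr (us[i := u + v])) = snd (ebr (us[i := u]) + ebr (us[i := v]))"
    proof
      fix z
      show "snd (ebr (us[i := u + v])) z = snd (ebr (us[i := u]) + ebr (us[i := v])) z"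
        unfolding snd_upd[OF closed(1)[OF uv]] snd_add plus_fun_apply snd_upd[OF uv(1)]
          snd_upd[OF uv(2)] minus_add_distrib[symmetric] sum.distrib[symmetric]
        using len i
        by (intro arg_cong[where f = uminus] sum.cong refl)
          (simp add: bracket_add dual_add[OF snd_nth_dual[OF us]])
    qed
  qed
  have scale: "ebr (us[i := ext_scale scale c u]) = ext_scale scale c (ebr (us[i := u]))"
    if u: "u \<in> E" for u c
  proof (rule prod_eqI)
    show "fst (ebr (us[i := ext_scale scale c u])) = fst (ext_scale scale c (ebr (us[i := u])))"
      using len i by (simp add: fst_ext_bracket map_update bracket_scale fst_ext_scale)
    show "snd (ebr (us[i := ext_scale scale c u])) = snd (ext_scale scale c (ebr (us[i := u])))"
      using len i
      by (auto simp: fun_eq_iff snd_upd u closed[OF u u] bracket_scale fst_ext_scale snd_ext_scale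
          dual_scale[OF snd_nth_dual[OF us]] sum_distrib_left intro!: sum.cong)
  qed
  show ?thesis
    using add scale by (simp add: linear_on_def)
qed

lemma nary_algebra_ext: "nary_algebra (ext_scale scale) E n ebr"
  unfolding nary_algebra_def nary_algebra_axioms_def
  using vector_space_ext subspace_ext_carrier ext_bracket_closed ext_bracket_multilinear by blast

section \<open>The Nambu identity of the extension\<close>

lemma snd_ext_bracket_snoc:
  assumes us: "us \<in> tuples E (n - 1)" and w: "w \<in> E"
  shows "snd (ebr (us @ [w])) z =
    - (\<Sum>k<n - 1. snd (us ! k) (br ((map fst us)[k := z] @ [fst w]))) - snd w (br (map fst us @ [z]))"
proof -
  obtain m where m: "n = Suc m" using n_pos by (cases n) auto
  have len: "length us = m" using us m by (simp add: tuples_def)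
  show ?thesis
    \<comment> \<open>Splitting position \<open>n - 1\<close> off the sum separates the functional
      of \<open>w\<close> from those of \<open>us\<close>.\<close>
    unfolding snd_ext_bracket[OF tuples_snoc[OF us w n_pos]]
    using len by (simp add: m nth_append list_update_append)
qed

lemma ext_nambu_identity:
  assumes us: "us \<in> tuples E (n - 1)" and vs: "vs \<in> tuples E n"
  shows "ebr (us @ [ebr vs]) = (\<Sum>i<n. ebr (vs[i := ebr (us @ [vs ! i])]))"
proof (rule prod_eqI)
  let ?xs = "map fst us" and ?ys = "map fst vs"
  let ?D = "\<lambda>y. br (?xs @ [y])"
  have xs: "length ?xs = n - 1" and ys: "length ?ys = n" and len: "length vs = n"
    using us vs by (auto simp: tuples_def)
  show "fst (ebr (us @ [ebr vs])) = fst (\<Sum>i<n. ebr (vs[i := ebr (us @ [vs ! i])]))"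
    using nambu_identity[OF xs ys] len
    by (simp add: fst_sum fst_ext_bracket map_update)
  show "snd (ebr (us @ [ebr vs])) = snd (\<Sum>i<n. ebr (vs[i := ebr (us @ [vs ! i])]))"
  proof
    fix z
    \<comment> \<open>In \<open>?T i j\<close> the operator \<open>?D\<close> acts on slot
      \<open>i\<close> while \<open>z\<close> fills slot \<open>j\<close>; the diagonal is
      \<open>0\<close> because the case \<open>i = j\<close> is accounted for separately each time.
      \<open>?F i\<close> collects the functionals of \<open>us\<close>.\<close>
    let ?T = "\<lambda>i j. if j = i then 0 else br (?ys[i := ?D (?ys ! i), j := z])"
    let ?F = "\<lambda>i. \<Sum>k<n - 1. snd (us ! k) (br (?xs[k := br (?ys[i := z])] @ [?ys ! i]))"
    have inner: "ebr (us @ [vs ! i]) \<in> E" if "i < n" for i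
      by (intro ext_bracket_closed tuples_snoc us n_pos tuples_nth[OF vs] that)
    \<comment> \<open>The Nambu identity for \<open>ys\<close> with \<open>z\<close> in slot
      \<open>j\<close>, with the summand in which \<open>z\<close> itself is acted on split
      off.\<close>
    have D: "?D (br (?ys[j := z])) = br (?ys[j := ?D z]) + (\<Sum>i<n. ?T i j)" if j: "j < n" for j
    proof -
      have "?D (br (?ys[j := z])) = (\<Sum>i<n. br (?ys[j := z, i := ?D (?ys[j := z] ! i)]))"
        using nambu_identity[OF xs, of "?ys[j := z]"] len by simp
      also have "\<dots> = (\<Sum>i<n. (if i = j then br (?ys[j := ?D z]) else 0) + ?T i j)"
        using len j by (intro sum.cong) (auto simp: list_update_swap)
      finally show ?thesis using j by (simp add: sum.distrib)
    qed
    have summand: "snd (ebr (vs[i := ebr (us @ [vs ! i])])) z =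
        - (\<Sum>j<n. snd (vs ! j) (?T i j)) + ?F i + snd (vs ! i) (?D (br (?ys[i := z])))"
      if i: "i < n" for i
    proof -
      have "snd (ebr (vs[i := ebr (us @ [vs ! i])])) z =
          - (\<Sum>j<n. snd (vs[i := ebr (us @ [vs ! i])] ! j) (br (?ys[i := ?D (?ys ! i), j := z])))"
        using snd_ext_bracket[OF tuples_list_update[OF vs inner[OF i]]] len i
        by (simp add: map_update fst_ext_bracket)
      \<comment> \<open>Only position \<open>i\<close> carries the functional of the inner bracket;
        there the update by \<open>z\<close> erases the inner vector part.\<close>
      also have "(\<Sum>j<n. snd (vs[i := ebr (us @ [vs ! i])] ! j) (br (?ys[i := ?D (?ys ! i), j := z])))
          = (\<Sum>j<n. snd (vs ! j) (?T i j) +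
              (if j = i then snd (ebr (us @ [vs ! i])) (br (?ys[i := z])) else 0))"
        using len by (intro sum.cong) (auto simp: dual_zero[OF snd_nth_dual[OF vs]])
      also have "\<dots> = (\<Sum>j<n. snd (vs ! j) (?T i j)) + snd (ebr (us @ [vs ! i])) (br (?ys[i := z]))"
        using i by (simp add: sum.distrib)
      also have "snd (ebr (us @ [vs ! i])) (br (?ys[i := z])) =
          - ?F i - snd (vs ! i) (?D (br (?ys[i := z])))"
        using snd_ext_bracket_snoc[OF us tuples_nth[OF vs i]] i len by simp
      finally show ?thesis by simp
    qed
    \<comment> \<open>Exchanging the sums and moving the one over \<open>i\<close> inside each
      functional \<open>snd (us ! k)\<close> exposes the left-hand side of the transposed
      identity.\<close>
    have F: "(\<Sum>i<n. ?F i) = - (\<Sum>k<n - 1. snd (us ! k) (br (?xs[k := z] @ [br ?ys])))"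
    proof -
      have "(\<Sum>i<n. ?F i) =
          (\<Sum>k<n - 1. snd (us ! k) (\<Sum>i<n. br (?xs[k := br (?ys[i := z])] @ [?ys ! i])))"
        by (subst sum.swap) (intro sum.cong refl, simp add: dual_sum[OF snd_nth_dual[OF us]])
      also have "\<dots> = (\<Sum>k<n - 1. - snd (us ! k) (br (?xs[k := z] @ [br ?ys])))"
        by (intro sum.cong refl)
          (simp only: nambu_identity_transposed[OF xs ys] lessThan_iff dual_uminus[OF snd_nth_dual[OF us]])
      finally show ?thesis by (simp add: sum_negf)
    qed
    have "snd (\<Sum>i<n. ebr (vs[i := ebr (us @ [vs ! i])])) z =
        (\<Sum>i<n. snd (ebr (vs[i := ebr (us @ [vs ! i])])) z)"
      by (simp add: snd_sum sum_fun_apply)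
    also have "\<dots> = - (\<Sum>i<n. \<Sum>j<n. snd (vs ! j) (?T i j)) + (\<Sum>i<n. ?F i)
        + (\<Sum>i<n. snd (vs ! i) (?D (br (?ys[i := z]))))"
      by (simp add: summand sum.distrib sum_negf sum_subtractf)
    also have "(\<Sum>i<n. snd (vs ! i) (?D (br (?ys[i := z])))) =
        (\<Sum>j<n. snd (vs ! j) (br (?ys[j := ?D z]))) + (\<Sum>j<n. \<Sum>i<n. snd (vs ! j) (?T i j))"
      unfolding sum.distrib[symmetric]
      by (intro sum.cong refl)
        (simp only: D lessThan_iff dual_add[OF snd_nth_dual[OF vs]] dual_sum[OF snd_nth_dual[OF vs]])
    also have "(\<Sum>j<n. \<Sum>i<n. snd (vs ! j) (?T i j)) = (\<Sum>i<n. \<Sum>j<n. snd (vs ! j) (?T i j))"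
      by (rule sum.swap)
    \<comment> \<open>The mixed double sums cancel, leaving the functionals of \<open>us\<close> and
      the terms in which \<open>z\<close> itself is acted on.\<close>
    also have "- (\<Sum>i<n. \<Sum>j<n. snd (vs ! j) (?T i j)) + (\<Sum>i<n. ?F i)
        + ((\<Sum>j<n. snd (vs ! j) (br (?ys[j := ?D z]))) + (\<Sum>i<n. \<Sum>j<n. snd (vs ! j) (?T i j)))
        = (\<Sum>i<n. ?F i) + (\<Sum>j<n. snd (vs ! j) (br (?ys[j := ?D z])))"
      by (simp only: algebra_simps) simp
    also have "\<dots> = snd (ebr (us @ [ebr vs])) z"
      unfolding F snd_ext_bracket_snoc[OF us ext_bracket_closed[OF vs]] snd_ext_bracket[OF vs]
        fst_ext_bracket by simp
    finally show "snd (ebr (us @ [ebr vs])) z = snd (\<Sum>i<n. ebr (vs[i := ebr (us @ [vs ! i])])) z"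
      by (rule sym)
  qed
qed

lemma nambu_algebra_ext: "nambu_algebra (ext_scale scale) E n ebr"
  using nary_algebra.nambu_algebra_iff[OF nary_algebra_ext n_pos] ext_nambu_identity by blast

section \<open>The bilinear form on the extension\<close>

lemma ext_form_conv: "ext_form B u v = B (fst u) (fst v) + snd u (fst v) + snd v (fst u)"
  by (simp add: ext_form_def case_prod_beta)

lemma ext_form_nondegenerate_symmetric:
  "nondegenerate_symmetric_bilinear (ext_scale scale) E (ext_form B)"
proof -
  have "u = 0" if u: "u \<in> E" and zero: "\<forall>v\<in>E. ext_form B u v = 0" for u
  proof -
    have "B (fst u) x = 0" for x
    proof -
      \<comment> \<open>Pairing \<open>u\<close> with this element gives \<open>B x (fst u)\<close>,
        so nondegeneracy of \<open>B\<close> yields \<open>fst u = 0\<close>. Pairing with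
        \<open>(x, 0)\<close> afterwards leaves \<open>snd u x\<close>.\<close>
      have "(0, B x) \<in> E"
        by (simp add: mem_ext_carrier_iff mem_dual_iff form_add_right form_scale_right)
      with zero have "ext_form B u (0, B x) = 0" by blast
      then show ?thesis
        using form_scale_right[of "fst u" 0 0] u
        by (simp add: ext_form_conv mem_ext_carrier_iff dual_zero form_sym)
    qed
    then have fst: "fst u = 0" by (rule form_nondegenerate)
    have "snd u x = 0" for x
    proof -
      have "(x, \<lambda>_. 0) \<in> E" by (simp add: mem_ext_carrier_iff mem_dual_iff)
      with zero have "ext_form B u (x, \<lambda>_. 0) = 0" by blast
      then show ?thesis
        using form_scale_left[of 0 0 x] fst by (simp add: ext_form_conv)
    qed
    with fst show ?thesis by (intro prod_eqI) (auto simp: fun_eq_iff)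
  qed
  then show ?thesis
    unfolding nondegenerate_symmetric_bilinear_def linear_on_def
    by (auto simp: ext_form_conv mem_ext_carrier_iff fst_ext_scale snd_ext_scale dual_add dual_scale
        form_add_left form_add_right form_scale_left form_scale_right algebra_simps
        intro: form_sym)
qed

text \<open>The functionals of \<open>v\<close> and \<open>w\<close> each occur twice with opposite
  signs. The terms with functionals of \<open>us\<close> cancel by swapping \<open>fst v\<close> and
  \<open>fst w\<close>, and the remaining \<open>B\<close>-terms by invariance of
  \<open>B\<close>.\<close>

lemma ext_form_invariant:
  assumes us: "us \<in> tuples E (n - 1)" and v: "v \<in> E" and w: "w \<in> E"
  shows "ext_form B (ebr (us @ [v])) w + ext_form B v (ebr (us @ [w])) = 0"
proof -
  let ?xs = "map fst us"
  have xs: "length ?xs = n - 1" using us by (simp add: tuples_def)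
  have "(\<Sum>k<n - 1. snd (us ! k) (br (?xs[k := fst w] @ [fst v]))) =
      - (\<Sum>k<n - 1. snd (us ! k) (br (?xs[k := fst v] @ [fst w])))"
    unfolding sum_negf[symmetric]
    by (intro sum.cong refl, subst bracket_swap_last[OF xs])
      (simp_all add: dual_uminus[OF snd_nth_dual[OF us]])
  then show ?thesis
    using form_invariant_last[OF xs, of "fst v" "fst w"]
    by (simp add: ext_form_conv fst_ext_bracket snd_ext_bracket_snoc[OF us v]
        snd_ext_bracket_snoc[OF us w])
qed

section \<open>The involution and the twisted extension\<close>

context
  fixes \<alpha> :: "'v \<Rightarrow> 'v"
  assumes automorphism: "\<alpha> \<in> symmetric_automorphisms scale UNIV n br B"
    and involution: "\<alpha> \<circ> \<alpha> = id"
begin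

lemma involution_apply: "\<alpha> (\<alpha> x) = x"
  using involution by (metis comp_apply id_apply)

lemma automorphism_add: "\<alpha> (x + y) = \<alpha> x + \<alpha> y"
  and automorphism_scale: "\<alpha> (scale c x) = scale c (\<alpha> x)"
  and automorphism_bracket: "length xs = n \<Longrightarrow> \<alpha> (br xs) = br (map \<alpha> xs)"
  and automorphism_symmetric: "B (\<alpha> x) y = B x (\<alpha> y)"
  using automorphism
  by (auto simp: symmetric_automorphisms_def endomorphism_on_def linear_on_def tuples_UNIV)

lemma fst_ext_map: "fst (ext_map \<alpha> u) = \<alpha> (fst u)"
  and snd_ext_map: "snd (ext_map \<alpha> u) = snd u \<circ> \<alpha>"
  by (simp_all add: ext_map_def case_prod_beta)

lemma ext_map_closed: "u \<in> E \<Longrightarrow> ext_map \<alpha> u \<in> E"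
  by (simp add: mem_ext_carrier_iff snd_ext_map mem_dual_iff automorphism_add automorphism_scale)

lemma ext_map_endomorphism: "endomorphism_on (ext_scale scale) E (ext_map \<alpha>)"
  unfolding endomorphism_on_def linear_on_def
  by (simp add: image_subset_iff ext_map_closed prod_eq_iff fst_ext_map snd_ext_map fst_ext_scale snd_ext_scale
      automorphism_add automorphism_scale fun_eq_iff)

lemma ext_map_bracket:
  assumes us: "us \<in> tuples E n"
  shows "ext_map \<alpha> (ebr us) = ebr (map (ext_map \<alpha>) us)"
proof (rule prod_eqI)
  let ?xs = "map fst us"
  have len: "length us = n" using us by (simp add: tuples_def)
  have us': "map (ext_map \<alpha>) us \<in> tuples E n"
    using us ext_map_closed by (intro tuples_map) auto
  have fsts: "map fst (map (ext_map \<alpha>) us) = map \<alpha> ?xs"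
    by (simp add: fst_ext_map)
  show "fst (ext_map \<alpha> (ebr us)) = fst (ebr (map (ext_map \<alpha>) us))"
    unfolding fst_ext_map fst_ext_bracket fsts using len by (simp add: automorphism_bracket)
  \<comment> \<open>Here \<open>\<alpha> \<circ> \<alpha> = id\<close> enters: the outer
    \<open>\<alpha>\<close> undoes the one on every \<open>x\<close> and lands on \<open>z\<close>,
    which matches precomposing the functional of the bracket with \<open>\<alpha>\<close>.\<close>
  have "\<alpha> (br ((map \<alpha> ?xs)[i := z])) = br (?xs[i := \<alpha> z])" for i z
    using len by (simp add: automorphism_bracket map_update o_def involution_apply)
  then show "snd (ext_map \<alpha> (ebr us)) = snd (ebr (map (ext_map \<alpha>) us))"
    unfolding snd_ext_map fun_eq_iff comp_apply snd_ext_bracket[OF us] snd_ext_bracket[OF us'] fsts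
    using len
    by (intro allI arg_cong[where f = uminus] sum.cong refl) (simp add: snd_ext_map)
qed

text \<open>A symmetric involution is an isometry. In the Hom-invariance of the twisted bracket both
  arguments of each form term carry \<open>ext_map \<alpha>\<close>, so this reduces it to
  \<open>ext_form_invariant\<close>.\<close>

lemma ext_form_ext_map: "ext_form B (ext_map \<alpha> u) (ext_map \<alpha> v) = ext_form B u v"
  by (simp add: ext_form_conv fst_ext_map snd_ext_map automorphism_symmetric involution_apply)

lemma multiplicative_ext:
  "multiplicative_hom_nambu_algebra (ext_scale scale) E n (ext_map \<alpha> \<circ> ebr)
     (replicate (n - 1) (ext_map \<alpha>))"
  by (rule multiplicative_twist[OF nambu_algebra_ext n_pos ext_map_endomorphism ext_map_bracket])

lemma hom_quadratic_ext:
  "hom_quadratic_hom_nambu_algebra (ext_scale scale) E n (ext_map \<alpha> \<circ> ebr)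
     (replicate (n - 1) (ext_map \<alpha>)) (ext_form B) (ext_map \<alpha>)"
proof -
  interpret ext: multiplicative_hom_nambu_algebra "ext_scale scale" E n "ext_map \<alpha> \<circ> ebr"
    "replicate (n - 1) (ext_map \<alpha>)"
    by (rule multiplicative_ext)
  show ?thesis
    by unfold_locales
      (auto simp: ext_form_nondegenerate_symmetric ext_map_endomorphism ext_form_ext_map
        ext_form_invariant)
qed

end

end

theorem theorem5p4:
  fixes scale :: "'k::{alg_closed_field, field_char_0} \<Rightarrow> 'v::ab_group_add \<Rightarrow> 'v"
    and n :: nat
    and br :: "'v list \<Rightarrow> 'v"
    and B :: "'v \<Rightarrow> 'v \<Rightarrow> 'k"
    and \<alpha> :: "'v \<Rightarrow> 'v"
  assumes "2 \<le> n"
    and "quadratic_nambu_lie_algebra scale UNIV n br B"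
    and "\<alpha> \<in> symmetric_automorphisms scale UNIV n br B"
    and "\<alpha> \<circ> \<alpha> = id"
  defines "\<Omega> \<equiv> (ext_map \<alpha> :: 'v \<times> ('v \<Rightarrow> 'k) \<Rightarrow> 'v \<times> ('v \<Rightarrow> 'k))"
  shows "hom_quadratic_hom_nambu_algebra (ext_scale scale) (ext_carrier scale) n
           (\<Omega> \<circ> ext_bracket n br) (replicate (n - 1) \<Omega>) (ext_form B) \<Omega>
       \<and> multiplicative_hom_nambu_algebra (ext_scale scale) (ext_carrier scale) n
           (\<Omega> \<circ> ext_bracket n br) (replicate (n - 1) \<Omega>)"
proof -
  interpret full_quadratic_nambu_lie_algebra scale n br B
    using assms(1,2)
    by (simp add: full_quadratic_nambu_lie_algebra_def full_quadratic_nambu_lie_algebra_axioms_def)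
  show ?thesis
    unfolding \<Omega>_def using hom_quadratic_ext multiplicative_ext assms(3,4) by blast
qed

end
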